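(* If a (constructor, orthogonal) TRS has a quasi-interpretation $(\!|-|\!)$ over $\mathbb{K}\in\{\mathbb{N},\mathbb{Q}^+,\mathbb{R}^+\}$, then $(\!|-|\!)$ is a DP-interpretation of that TRS.
   Context: A constructor TRS consists of disjoint sets $\mathcal{C}$ (constructors) and $\mathcal{D}$ (defined symbols) with fixed arities, variables, and finitely many rules $l\to r$ with $l=\mathtt{f}(t_1,\dots,t_n)$, $\mathtt{f}\in\mathcal{D}$, $t_i$ built from constructors and variables, variables of $r$ occurring in $l$. An assignment over $\mathbb{K}$ maps each symbol of arity $m$ to a total function $\mathbb{K}^m\to\mathbb{K}$, extended homomorphically to terms; monotonic means every function is nondecreasing in each argument. A quasi-interpretation is a monotonic assignment with $(\!|l|\!)\geq(\!|r|\!)$ for every rule (for all variable values) and $(\!|\mathtt{g}|\!)(X_1,\dots,X_m)\geq X_i$ for every symbol $\mathtt{g}$ of arity $m$ and every $i$. Dependency pairs: for each $\mathtt{f}\in\mathcal{D}$ a fresh symbol $\mathtt{f}^\sharp$ of the same arity; for $t=\mathtt{f}(t_1,\dots,t_n)$, $t^\sharp=\mathtt{f}^\sharp(t_1,\dots,t_n)$; $l^\sharp\to u^\sharp$ is a dependency pair if $u$ has a defined root symbol, $l\to C[u]$ is a rule for some context $C$, and $u$ is not a proper subterm of $l$. A DP-interpretation is a monotonic assignment extended by giving $\mathtt{f}^\sharp$ the same function as $\mathtt{f}$, satisfying the rule inequalities $\geq$ and $\langle\!\langle l^\sharp\rangle\!\rangle\geq\langle\!\langle u^\sharp\rangle\!\rangle$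 for every dependency pair. *)

theory Defs
  imports Complex_Main
begin

datatype (syms: 'f, vars: 'v) trm = Var 'v | Fun 'f "('f, 'v) trm list"

type_synonym ('f, 'v) rule = "('f, 'v) trm \<times> ('f, 'v) trm"

text \<open>Terms respecting arities, with all symbols taken from \<open>F\<close>.\<close>

fun trm_over :: "'f set \<Rightarrow> ('f \<Rightarrow> nat) \<Rightarrow> ('f, 'v) trm \<Rightarrow> bool" where
  "trm_over F ar (Var x) \<longleftrightarrow> True"
| "trm_over F ar (Fun f ts) \<longleftrightarrow> f \<in> F \<and> length ts = ar f \<and> (\<forall>t \<in> set ts. trm_over F ar t)"

fun subst :: "('v \<Rightarrow> ('f, 'w) trm) \<Rightarrow> ('f, 'v) trm \<Rightarrow> ('f, 'w) trm" where
  "subst \<sigma> (Var x) = \<sigma> x"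
| "subst \<sigma> (Fun f ts) = Fun f (map (subst \<sigma>) ts)"

text \<open>Variables with repetitions, in order of occurrence.\<close>

fun vars_list :: "('f, 'v) trm \<Rightarrow> 'v list" where
  "vars_list (Var x) = [x]"
| "vars_list (Fun f ts) = concat (map vars_list ts)"

datatype ('f, 'v) ctxt =
  Hole
| More 'f "('f, 'v) trm list" "('f, 'v) ctxt" "('f, 'v) trm list"

fun fill :: "('f, 'v) ctxt \<Rightarrow> ('f, 'v) trm \<Rightarrow> ('f, 'v) trm" where
  "fill Hole t = t"
| "fill (More f ss C ts) t = Fun f (ss @ fill C t # ts)"

definition proper_subterm :: "('f, 'v) trm \<Rightarrow> ('f, 'v) trm \<Rightarrow> bool" where
  "proper_subterm u t \<longleftrightarrow> (\<exists>C. C \<noteq> Hole \<and> t = fill C u)"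


definition constructor_trs ::
  "'f set \<Rightarrow> 'f set \<Rightarrow> ('f \<Rightarrow> nat) \<Rightarrow> ('f, 'v) rule set \<Rightarrow> bool" where
  "constructor_trs Cs Ds ar R \<longleftrightarrow>
     Cs \<inter> Ds = {} \<and> finite R \<and>
     (\<forall>(l, r) \<in> R.
        (\<exists>f ts. l = Fun f ts \<and> f \<in> Ds \<and> length ts = ar f \<and> (\<forall>t \<in> set ts. trm_over Cs ar t)) \<and>
        trm_over (Cs \<union> Ds) ar r \<and>
        vars r \<subseteq> vars l)"

definition left_linear :: "('f, 'v) rule set \<Rightarrow> bool" where
  "left_linear R \<longleftrightarrow> (\<forall>(l, r) \<in> R. distinct (vars_list l))"

definition variants :: "('f, 'v) rule \<Rightarrow> ('f, 'v) rule \<Rightarrow> bool" where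
  "variants \<rho>1 \<rho>2 \<longleftrightarrow>
     (\<exists>\<pi>. bij \<pi> \<and> fst \<rho>2 = map_trm id \<pi> (fst \<rho>1) \<and> snd \<rho>2 = map_trm id \<pi> (snd \<rho>1))"

text \<open>
  The left-hand side of \<open>\<rho>2\<close> overlaps that of \<open>\<rho>1\<close> at a non-variable position; using two
  independent substitutions amounts to unification after renaming the rules apart. The trivial
  overlap of a rule with (a renamed copy of) itself at the root is excluded.
\<close>

definition overlap :: "('f, 'v) rule \<Rightarrow> ('f, 'v) rule \<Rightarrow> bool" where
  "overlap \<rho>1 \<rho>2 \<longleftrightarrow>
     (\<exists>C f us (\<sigma> :: 'v \<Rightarrow> ('f, 'v) trm) (\<tau> :: 'v \<Rightarrow> ('f, 'v) trm).
        fst \<rho>1 = fill C (Fun f us) \<and>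
        subst \<sigma> (Fun f us) = subst \<tau> (fst \<rho>2) \<and>
        (C = Hole \<longrightarrow> \<not> variants \<rho>1 \<rho>2))"

definition orthogonal :: "('f, 'v) rule set \<Rightarrow> bool" where
  "orthogonal R \<longleftrightarrow> left_linear R \<and> (\<forall>\<rho>1 \<in> R. \<forall>\<rho>2 \<in> R. \<not> overlap \<rho>1 \<rho>2)"


datatype 'f marked = Plain 'f | Sharp 'f

text \<open>Terms are marked at the root only; the value on variables is irrelevant.\<close>

fun sharp :: "('f, 'v) trm \<Rightarrow> ('f marked, 'v) trm" where
  "sharp (Fun f ts) = Fun (Sharp f) (map (map_trm Plain id) ts)"
| "sharp (Var x) = Var x"

definition dependency_pairs ::
  "'f set \<Rightarrow> ('f, 'v) rule set \<Rightarrow> ('f marked, 'v) rule set" where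
  "dependency_pairs Ds R =
     {(sharp l, sharp u) | l u.
        (\<exists>g us. u = Fun g us \<and> g \<in> Ds) \<and>
        (\<exists>C. (l, fill C u) \<in> R) \<and>
        \<not> proper_subterm u l}"


text \<open>
  The domain is a set \<open>K\<close> of reals. The function assigned to a symbol of arity \<open>m\<close> is represented
  by its values on the lists in \<open>tuples K m\<close>; its values elsewhere are irrelevant.
\<close>

definition tuples :: "real set \<Rightarrow> nat \<Rightarrow> real list set" where
  "tuples K m = {xs. length xs = m \<and> set xs \<subseteq> K}"

fun eval :: "('f \<Rightarrow> real list \<Rightarrow> real) \<Rightarrow> ('v \<Rightarrow> real) \<Rightarrow> ('f, 'v) trm \<Rightarrow> real" where
  "eval I \<alpha> (Var x) = \<alpha> x"
| "eval I \<alpha> (Fun f ts) = I f (map (eval I \<alpha>) ts)"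

definition assignment ::
  "real set \<Rightarrow> 'f set \<Rightarrow> ('f \<Rightarrow> nat) \<Rightarrow> ('f \<Rightarrow> real list \<Rightarrow> real) \<Rightarrow> bool" where
  "assignment K F ar I \<longleftrightarrow> (\<forall>f \<in> F. \<forall>xs \<in> tuples K (ar f). I f xs \<in> K)"

definition monotonic ::
  "real set \<Rightarrow> 'f set \<Rightarrow> ('f \<Rightarrow> nat) \<Rightarrow> ('f \<Rightarrow> real list \<Rightarrow> real) \<Rightarrow> bool" where
  "monotonic K F ar I \<longleftrightarrow>
     (\<forall>f \<in> F. \<forall>xs \<in> tuples K (ar f). \<forall>i < ar f. \<forall>y \<in> K.
        xs ! i \<le> y \<longrightarrow> I f xs \<le> I f (xs[i := y]))"

definition weakly_decreasing ::
  "real set \<Rightarrow> ('f \<Rightarrow> real list \<Rightarrow> real) \<Rightarrow> ('f, 'v) rule set \<Rightarrow> bool" where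
  "weakly_decreasing K I R \<longleftrightarrow>
     (\<forall>(l, r) \<in> R. \<forall>\<alpha>. range \<alpha> \<subseteq> K \<longrightarrow> eval I \<alpha> l \<ge> eval I \<alpha> r)"

definition quasi_interpretation ::
  "real set \<Rightarrow> 'f set \<Rightarrow> 'f set \<Rightarrow> ('f \<Rightarrow> nat) \<Rightarrow> ('f, 'v) rule set \<Rightarrow>
   ('f \<Rightarrow> real list \<Rightarrow> real) \<Rightarrow> bool" where
  "quasi_interpretation K Cs Ds ar R I \<longleftrightarrow>
     assignment K (Cs \<union> Ds) ar I \<and> monotonic K (Cs \<union> Ds) ar I \<and>
     weakly_decreasing K I R \<and>
     (\<forall>g \<in> Cs \<union> Ds. \<forall>xs \<in> tuples K (ar g). \<forall>i < ar g. I g xs \<ge> xs ! i)"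

fun sharp_extension ::
  "('f \<Rightarrow> real list \<Rightarrow> real) \<Rightarrow> 'f marked \<Rightarrow> real list \<Rightarrow> real" where
  "sharp_extension I (Plain f) = I f"
| "sharp_extension I (Sharp f) = I f"

definition dp_interpretation ::
  "real set \<Rightarrow> 'f set \<Rightarrow> 'f set \<Rightarrow> ('f \<Rightarrow> nat) \<Rightarrow> ('f, 'v) rule set \<Rightarrow>
   ('f \<Rightarrow> real list \<Rightarrow> real) \<Rightarrow> bool" where
  "dp_interpretation K Cs Ds ar R I \<longleftrightarrow>
     assignment K (Cs \<union> Ds) ar I \<and> monotonic K (Cs \<union> Ds) ar I \<and>
     weakly_decreasing K I R \<and>
     weakly_decreasing K (sharp_extension I) (dependency_pairs Ds R)"

end

theory Submission
  imports Defs
begin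

text \<open>
  Marking the root does not change the value of a term, and the subterm property of a
  quasi-interpretation gives \<open>eval I \<alpha> l \<ge> eval I \<alpha> r \<ge> eval I \<alpha> u\<close>
  for every subterm \<open>u\<close> of a right-hand side \<open>r\<close>.
\<close>

lemma eval_map_Plain: "eval (sharp_extension I) \<alpha> (map_trm Plain id t) = eval I \<alpha> t"
  by (induction t) (simp_all add: id_def comp_def cong: map_cong)

lemma eval_sharp: "eval (sharp_extension I) \<alpha> (sharp t) = eval I \<alpha> t"
  by (cases t) (simp_all add: eval_map_Plain[unfolded id_def] comp_def id_def)

text \<open>The subterm property of \<open>I\<close> is stated only for arguments in
  \<open>K\<close>; this lemma makes it applicable to the values of subterms.\<close>

lemma eval_closed:
  assumes "assignment K F ar I" "range \<alpha> \<subseteq> K" "trm_over F ar t"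
  shows "eval I \<alpha> t \<in> K"
  using assms(3)
proof (induction t)
  case (Var x)
  then show ?case using assms(2) by auto
next
  case (Fun f ts)
  then have "map (eval I \<alpha>) ts \<in> tuples K (ar f)"
    by (auto simp: tuples_def)
  then show ?case
    using assms(1) Fun.prems by (simp add: assignment_def)
qed

text \<open>Each layer of the context costs one use of the subterm property, at the argument that
  contains the hole.\<close>

lemma eval_fill_ge:
  assumes "assignment K F ar I"
    and subterm: "\<forall>g \<in> F. \<forall>xs \<in> tuples K (ar g). \<forall>i < ar g. I g xs \<ge> xs ! i"
    and "range \<alpha> \<subseteq> K" "trm_over F ar (fill C u)"
  shows "eval I \<alpha> u \<le> eval I \<alpha> (fill C u)"
  using assms(4)
proof (induction C)
  case (More f ss C ts)
  let ?xs = "map (eval I \<alpha>) (ss @ fill C u # ts)"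
  have "?xs \<in> tuples K (ar f)"
    using More.prems eval_closed[OF assms(1,3)] by (auto simp: tuples_def)
  \<comment> \<open>Counting from 0, \<open>length ss\<close> is the position of the argument
    \<open>fill C u\<close>.\<close>
  moreover have "length ss < ar f" "f \<in> F"
    using More.prems by auto
  ultimately have "?xs ! length ss \<le> I f ?xs"
    using subterm by blast
  then have "eval I \<alpha> (fill C u) \<le> eval I \<alpha> (fill (More f ss C ts) u)"
    by (simp add: nth_append)
  with More show ?case by fastforce
qed simp

theorem theorem25:
  fixes Cs Ds :: "'f set"
    and ar :: "'f \<Rightarrow> nat"
    and R :: "('f, 'v) rule set"
    and K :: "real set"
    and I :: "'f \<Rightarrow> real list \<Rightarrow> real"
  assumes "constructor_trs Cs Ds ar R"
    and "orthogonal R"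
    and "K \<in> {\<nat>, {q \<in> \<rat>. q \<ge> 0}, {x. x \<ge> 0}}"
    and "quasi_interpretation K Cs Ds ar R I"
  shows "dp_interpretation K Cs Ds ar R I"
proof -
  have qi: "assignment K (Cs \<union> Ds) ar I" "monotonic K (Cs \<union> Ds) ar I" "weakly_decreasing K I R"
    "\<forall>g \<in> Cs \<union> Ds. \<forall>xs \<in> tuples K (ar g). \<forall>i < ar g. I g xs \<ge> xs ! i"
    using assms(4) by (simp_all add: quasi_interpretation_def)
  have "eval I \<alpha> u \<le> eval I \<alpha> l" if "(l, fill C u) \<in> R" "range \<alpha> \<subseteq> K" for l u C \<alpha>
  proof -
    \<comment> \<open>\<open>fill C u\<close> is the right-hand side of a rule, so it respects
      arities.\<close>
    have "trm_over (Cs \<union> Ds) ar (fill C u)"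
      using assms(1) that(1) by (auto simp: constructor_trs_def)
    then have "eval I \<alpha> u \<le> eval I \<alpha> (fill C u)"
      by (rule eval_fill_ge[OF qi(1,4) that(2)])
    also have "\<dots> \<le> eval I \<alpha> l"
      using qi(3) that by (auto simp: weakly_decreasing_def)
    finally show ?thesis .
  qed
  \<comment> \<open>\<open>eval_sharp\<close> removes the marks from both sides of a pair. As
    \<open>u\<close> is \<open>Fun g us\<close>, \<open>sharp.simps\<close> would rewrite
    \<open>sharp u\<close> before that equation could apply.\<close>
  then have "weakly_decreasing K (sharp_extension I) (dependency_pairs Ds R)"
    by (auto simp: weakly_decreasing_def dependency_pairs_def eval_sharp simp del: sharp.simps eval.simps)
  with qi show ?thesis by (simp add: dp_interpretation_def)
qed

end
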